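(* Let $m\ge 3$, $V=\mathbb{F}_2^m$, and $C=RM(1,m)\subseteq\mathbb{F}_2^V$, with dual $C^\perp$. Let $U\subset V$ be a three-dimensional subspace, and let $H_8=\{c|_U\mid c\in C\}\subseteq \mathbb{F}_2^U$ (the code of affine linear functions on $U$, an extended Hamming code of length $8$). Let $k$ be a positive integer and let $f$ be a harmonic function of degree $k$ on the coordinate set $V$ such that $f(z)=0$ for every $k$-subset $z$ of $V$ not contained in $U$. Then \[ w_{C,f}(x,y)=2^{m-3}x^{2^{m-1}}y^{2^{m-1}}\sum_{a\in H_8,\ \mathrm{wt}(a)=4}\widetilde{f}(a), \] \[ w_{C^\perp,f}(x,y)=(-1)^k(xy)^k\, 2^{2^{m-1}-4}\left(\frac{x+y}{\sqrt{2}}\right)^{2^{m-1}-k}\left(\frac{x-y}{\sqrt{2}}\right)^{2^{m-1}-k}\sum_{a\in H_8,\ \mathrm{wt}(a)=4}\widetilde{f}(a), \] where for $a\in H_8$, $\widetilde{f}(a)$ means $\widetilde f$ evaluated at $\mathrm{supp}(a)\subseteq U\subseteq V$.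
   Context: $RM(1,m)=\{(\lambda(x)+b)_{x\in V}\mid \lambda\in \mathrm{Hom}(V,\mathbb{F}_2),\ b\in\mathbb{F}_2\}$, with coordinates indexed by $V$; $c|_U=(c_x)_{x\in U}$; $\mathrm{wt}$ is the Hamming weight and $\mathrm{supp}(c)$ the set of coordinates where $c$ is nonzero. Let $X$ be the set of all subsets of $V$ and $X_k$ the set of $k$-subsets; $\mathbb{R}X_k$ is the real vector space with basis $X_k$, whose elements $f=\sum_{z\in X_k}f(z)z$ are identified with functions $X_k\to\mathbb{R}$. For $f\in\mathbb{R}X_k$ define $\widetilde f(u)=\sum_{z\in X_k,\,z\subseteq u}f(z)$ for $u\in X$. The linear map $\gamma$ on $\mathbb{R}X$ is defined by $\gamma(z)=\sum_{y\in X_{k-1},\,y\subseteq z}y$ for $z\in X_k$. A harmonic function of degree $k$ is an $f\in\mathbb{R}X_k$ with $\gamma(f)=0$. For a binary code $D$ of length $n$ with coordinates $V$, the harmonic weight enumerator is $w_{D,f}(x,y)=\sum_{c\in D}\widetilde f(\mathrm{supp}(c))x^{n-\mathrm{wt}(c)}y^{\mathrm{wt}(c)}$. *)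

theory Defs
  imports
    "HOL-Analysis.Cartesian_Space"
    "HOL-Library.Z2"
    "HOL-Library.FuncSet"
    "HOL-Computational_Algebra.Polynomial"
begin

instance bit :: finite
proof
  have "(UNIV :: bit set) = {0, 1}"
    by (auto intro: bit.exhaust)
  then show "finite (UNIV :: bit set)"
    by (metis finite.emptyI finite.insertI)
qed

text \<open>
  The coordinate set \<open>V\<close> is a finite type \<open>'v\<close>, a word of length \<open>CARD('v)\<close> is a function
  \<open>'v \<Rightarrow> bit\<close>, and a word with coordinates in a subset \<open>A\<close> is such a function that is
  \<open>extensional\<close> on \<open>A\<close>. Since values outside \<open>A\<close> are then meaningless, \<open>supp\<close> and \<open>wt\<close>
  take the coordinate set as an argument.
\<close>

definition supp :: "'v set \<Rightarrow> ('v \<Rightarrow> bit) \<Rightarrow> 'v set"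
  where "supp A c = {x \<in> A. c x \<noteq> 0}"

definition wt :: "'v set \<Rightarrow> ('v \<Rightarrow> bit) \<Rightarrow> nat"
  where "wt A c = card (supp A c)"

definition dual_code :: "('v::finite \<Rightarrow> bit) set \<Rightarrow> ('v \<Rightarrow> bit) set"
  where "dual_code D = {d. \<forall>c\<in>D. (\<Sum>x\<in>UNIV. c x * d x) = 0}"

definition restrict_code :: "'v set \<Rightarrow> ('v \<Rightarrow> bit) set \<Rightarrow> ('v \<Rightarrow> bit) set"
  where "restrict_code U D = {restrict c U | c. c \<in> D}"

text \<open>\<open>RM(1,m)\<close> with \<open>m = CARD('m)\<close>.\<close>

definition RM1 :: "(bit ^ 'm \<Rightarrow> bit) set"
  where "RM1 = {(\<lambda>x. l x + b) | l b. Vector_Spaces.linear (*s) (*) l}"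

text \<open>
  Elements of \<open>\<real>X\<close> are functions \<open>'v set \<Rightarrow> real\<close>; \<open>RX k\<close> is the subspace spanned by the
  \<open>k\<close>-subsets.
\<close>

definition ksubsets :: "nat \<Rightarrow> 'v::finite set set"
  where "ksubsets k = {z. card z = k}"

definition RX :: "nat \<Rightarrow> ('v::finite set \<Rightarrow> real) set"
  where "RX k = {f. \<forall>z. z \<notin> ksubsets k \<longrightarrow> f z = 0}"

definition ftilde :: "nat \<Rightarrow> ('v::finite set \<Rightarrow> real) \<Rightarrow> 'v set \<Rightarrow> real"
  where "ftilde k f u = (\<Sum>z \<in> {z \<in> ksubsets k. z \<subseteq> u}. f z)"

text \<open>\<open>gamma_basis z\<close> is \<open>\<gamma>(z)\<close> for a basis element \<open>z\<close>; in particular \<open>\<gamma>(\<emptyset>) = 0\<close>.\<close>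

definition gamma_basis :: "'v::finite set \<Rightarrow> ('v set \<Rightarrow> real)"
  where "gamma_basis z = (\<lambda>y. if y \<subseteq> z \<and> card y + 1 = card z then 1 else 0)"

definition gamma :: "('v::finite set \<Rightarrow> real) \<Rightarrow> ('v set \<Rightarrow> real)"
  where "gamma f = (\<lambda>y. \<Sum>z\<in>UNIV. f z * gamma_basis z y)"

definition harmonic :: "nat \<Rightarrow> ('v::finite set \<Rightarrow> real) \<Rightarrow> bool"
  where "harmonic k f \<longleftrightarrow> f \<in> RX k \<and> gamma f = (\<lambda>_. 0)"

text \<open>The polynomial ring \<open>\<real>[x,y]\<close> is \<open>real poly poly\<close>, i.e. \<open>\<real>[y][x]\<close>.\<close>

definition const_xy :: "real \<Rightarrow> real poly poly"
  where "const_xy a = [:[:a:]:]"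

definition var_x :: "real poly poly"
  where "var_x = [:0, 1:]"

definition var_y :: "real poly poly"
  where "var_y = [:[:0, 1:]:]"

definition harmonic_weight_enum ::
    "('v::finite \<Rightarrow> bit) set \<Rightarrow> nat \<Rightarrow> ('v set \<Rightarrow> real) \<Rightarrow> real poly poly"
  where "harmonic_weight_enum D k f =
    (\<Sum>c\<in>D. const_xy (ftilde k f (supp UNIV c)) *
        var_x ^ (CARD('v) - wt UNIV c) * var_y ^ wt UNIV c)"

end

theory Submission
  imports Defs
begin

text \<open>
  A function \<open>f\<close> is harmonic of degree \<open>k\<close> exactly when the multilinear form
  \<open>F(a) = \<Sum>\<^sub>z f(z) \<Prod>\<^sub>i\<^sub>\<in>\<^sub>z a\<^sub>i\<close> is homogeneous of degree \<open>k\<close> and invariant under the translations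
  \<open>a\<^sub>i \<mapsto> a\<^sub>i + t\<close>. Applied to the Fourier transform of \<open>v \<mapsto> f~(supp v) x\<^bsup>n - wt v\<^esup> y\<^bsup>wt v\<^esup>\<close>, this
  invariance turns Poisson summation over a linear code into the MacWilliams identity for harmonic
  weight enumerators. A nonconstant affine function on \<open>V\<close> has weight \<open>2\<^bsup>m-1\<^esup>\<close>, the constant ones
  contribute nothing because \<open>f~\<close> vanishes at \<open>\<emptyset>\<close> and \<open>V\<close>, and every word of \<open>H\<^sub>8\<close> is the restriction
  of \<open>2\<^bsup>m-3\<^esup>\<close> words of \<open>C\<close>. This gives the first formula, and the MacWilliams identity the second.
\<close>

declare add_bit_eq_xor [simp del] mult_bit_eq_and [simp del]

section \<open>Harmonic functions and multilinear forms\<close>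

definition homogeneous :: "nat \<Rightarrow> ('v::finite set \<Rightarrow> 'r::comm_ring_1) \<Rightarrow> bool"
  where "homogeneous k h \<longleftrightarrow> (\<forall>z. card z \<noteq> k \<longrightarrow> h z = 0)"

text \<open>
  Harmonic functions with coefficients in an arbitrary ring: in the presence of torsion, the
  vanishing of the sums with \<open>card y = k - 1\<close> does not imply that of the others.
\<close>

definition null_design :: "nat \<Rightarrow> ('v::finite set \<Rightarrow> 'r::comm_ring_1) \<Rightarrow> bool"
  where "null_design k h \<longleftrightarrow>
    homogeneous k h \<and> (\<forall>y. card y < k \<longrightarrow> (\<Sum>z | y \<subseteq> z. h z) = 0)"

definition multilinear_form :: "('v::finite set \<Rightarrow> 'r::comm_ring_1) \<Rightarrow> ('v \<Rightarrow> 'r) \<Rightarrow> 'r"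
  where "multilinear_form h a = (\<Sum>z\<in>UNIV. h z * (\<Prod>i\<in>z. a i))"

lemma homogeneousD: "homogeneous k h \<Longrightarrow> card z \<noteq> k \<Longrightarrow> h z = 0"
  by (simp add: homogeneous_def)

lemma homogeneous_mult_cong:
  assumes "homogeneous k h" and "card z = k \<Longrightarrow> a = b"
  shows "h z * a = h z * b"
  using assms by (cases "card z = k") (simp_all add: homogeneousD)

lemma homogeneous_sum_Pow_eq_0:
  assumes "homogeneous k h" "card u < k"
  shows "sum h (Pow u) = 0"
proof (intro sum.neutral ballI)
  fix z assume "z \<in> Pow u"
  then have "card z \<le> card u" by (intro card_mono) auto
  then show "h z = 0" using assms by (simp add: homogeneousD)
qed

lemma homogeneous_sum_supersets:
  assumes "homogeneous k h"
  shows "of_nat (k - card y) * (\<Sum>z | y \<subseteq> z. h z) = (\<Sum>i\<in>-y. \<Sum>z | insert i y \<subseteq> z. h z)"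
proof -
  have "of_nat (k - card y) * (\<Sum>z | y \<subseteq> z. h z) = (\<Sum>z | y \<subseteq> z. h z * of_nat (card (z - y)))"
    unfolding sum_distrib_left
  proof (intro sum.cong refl)
    fix z assume "z \<in> {z. y \<subseteq> z}"
    then show "of_nat (k - card y) * h z = h z * of_nat (card (z - y))"
      unfolding mult.commute[of _ "h z"]
      by (intro homogeneous_mult_cong[OF assms]) (simp add: card_Diff_subset)
  qed
  also have "\<dots> = (\<Sum>z | y \<subseteq> z. \<Sum>i | i \<in> -y \<and> i \<in> z. h z)"
    by (simp add: set_diff_eq conj_commute mult.commute)
  also have "\<dots> = (\<Sum>i\<in>-y. \<Sum>z | insert i y \<subseteq> z. h z)"
    using sum.swap_restrict[of "{z. y \<subseteq> z}" "-y" "\<lambda>z i. h z" "\<lambda>z i. i \<in> z"]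
    by (simp add: conj_commute)
  finally show ?thesis .
qed

lemma harmonic_imp_null_design:
  assumes "harmonic k f"
  shows "null_design k f"
proof -
  have homogeneous: "homogeneous k f"
    using assms by (simp add: harmonic_def RX_def ksubsets_def homogeneous_def)
  have "(\<Sum>z | y \<subseteq> z. f z) = 0" if "card y < k" for y
    using that
  proof (induction "k - card y" arbitrary: y rule: less_induct)
    case less
    show ?case
    proof (cases "card y + 1 = k")
      case True
      have "0 = gamma f y"
        using assms by (simp add: harmonic_def)
      also have "\<dots> = (\<Sum>z\<in>UNIV. if y \<subseteq> z then f z else 0)"
        unfolding gamma_def gamma_basis_def using True homogeneousD[OF homogeneous]
        by (intro sum.cong) auto
      also have "\<dots> = (\<Sum>z | y \<subseteq> z. f z)"
        by (simp add: sum.If_cases)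
      finally show ?thesis by simp
    next
      case False
      have "(\<Sum>z | insert i y \<subseteq> z. f z) = 0" if "i \<in> -y" for i
      proof -
        have "card (insert i y) = Suc (card y)" using that by simp
        then show ?thesis using False less.prems by (intro less.hyps) auto
      qed
      then have "of_nat (k - card y) * (\<Sum>z | y \<subseteq> z. f z) = 0"
        unfolding homogeneous_sum_supersets[OF homogeneous] by (rule sum.neutral[OF ballI])
      then show ?thesis using less.prems by simp
    qed
  qed
  then show ?thesis using homogeneous by (simp add: null_design_def)
qed

lemma null_design_homogeneous: "null_design k h \<Longrightarrow> homogeneous k h"
  by (simp add: null_design_def)

lemma null_design_sum_supersets_power:
  assumes "null_design k h"
  shows "(\<Sum>z | y \<subseteq> z. h z * t ^ card (z - y)) = h y"
proof -
  note homogeneous = null_design_homogeneous[OF assms]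
  have "(\<Sum>z | y \<subseteq> z. h z * t ^ card (z - y)) = (\<Sum>z | y \<subseteq> z. h z * t ^ (k - card y))"
    by (intro sum.cong refl homogeneous_mult_cong[OF homogeneous]) (simp add: card_Diff_subset)
  also have "\<dots> = (\<Sum>z | y \<subseteq> z. h z) * t ^ (k - card y)"
    by (rule sum_distrib_right[symmetric])
  also have "\<dots> = h y"
  proof (cases "card y < k")
    case True
    then show ?thesis using assms by (simp add: null_design_def homogeneousD[OF homogeneous])
  next
    case False
    have "(\<Sum>z | y \<subseteq> z. h z) = (\<Sum>z\<in>{y}. h z)"
    proof (rule sum.mono_neutral_right)
      show "\<forall>z\<in>{z. y \<subseteq> z} - {y}. h z = 0"
      proof
        fix z assume "z \<in> {z. y \<subseteq> z} - {y}"
        then have "card y < card z" by (intro psubset_card_mono) auto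
        then show "h z = 0" using False by (intro homogeneousD[OF homogeneous]) simp
      qed
    qed auto
    then show ?thesis using False by simp
  qed
  finally show ?thesis .
qed

lemma multilinear_form_translation:
  assumes "null_design k h"
  shows "multilinear_form h (\<lambda>i. a i + t) = multilinear_form h a"
proof -
  let ?term = "\<lambda>z y. h z * ((\<Prod>i\<in>y. a i) * t ^ card (z - y))"
  have "multilinear_form h (\<lambda>i. a i + t) = (\<Sum>z\<in>UNIV. \<Sum>y | y \<in> UNIV \<and> y \<subseteq> z. ?term z y)"
    by (simp add: multilinear_form_def prod_add sum_distrib_left Pow_def)
  also have "\<dots> = (\<Sum>y\<in>UNIV. \<Sum>z | z \<in> UNIV \<and> y \<subseteq> z. ?term z y)"
    by (rule sum.swap_restrict) simp_all
  also have "\<dots> = (\<Sum>y\<in>UNIV. (\<Sum>z | y \<subseteq> z. h z * t ^ card (z - y)) * (\<Prod>i\<in>y. a i))"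
    by (simp add: sum_distrib_left sum_distrib_right ac_simps)
  also have "\<dots> = multilinear_form h a"
    by (simp add: null_design_sum_supersets_power[OF assms] multilinear_form_def)
  finally show ?thesis .
qed

lemma multilinear_form_scale:
  assumes "homogeneous k h"
  shows "multilinear_form h (\<lambda>i. t * a i) = t ^ k * multilinear_form h a"
  unfolding multilinear_form_def sum_distrib_left mult.left_commute[of "t ^ k"]
  by (intro sum.cong refl homogeneous_mult_cong[OF assms]) (simp add: prod.distrib)

lemma multilinear_form_indicator:
  fixes h :: "'v::finite set \<Rightarrow> 'r::comm_ring_1"
  shows "multilinear_form h (\<lambda>i. of_bool (i \<in> u)) = sum h (Pow u)"
proof -
  have prod_indicator: "(\<Prod>i\<in>z. of_bool (i \<in> u)) = (of_bool (z \<subseteq> u) :: 'r)" for z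
    by (induction z rule: finite_induct[OF finite]) auto
  show ?thesis
    unfolding multilinear_form_def prod_indicator by (simp add: sum_mult_of_bool_eq Pow_def)
qed

lemma null_design_sum_Pow_Compl:
  assumes "null_design k h"
  shows "sum h (Pow (- u)) = (- 1) ^ k * sum h (Pow u)"
proof -
  have "sum h (Pow (- u)) = multilinear_form h (\<lambda>i. - 1 * of_bool (i \<in> u) + 1)"
    unfolding multilinear_form_indicator[symmetric] by (simp add: of_bool_not_iff)
  also have "\<dots> = (- 1) ^ k * sum h (Pow u)"
    by (simp only: multilinear_form_translation[OF assms]
        multilinear_form_scale[OF null_design_homogeneous[OF assms]] multilinear_form_indicator)
  finally show ?thesis .
qed

lemma null_design_sum_Pow_nonzero:
  assumes "null_design k h" "sum h (Pow u) \<noteq> 0"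
  shows "k \<le> card u" "k \<le> card (- u)"
proof -
  note vanish = homogeneous_sum_Pow_eq_0[OF null_design_homogeneous[OF assms(1)]]
  show "k \<le> card u" using vanish[of u] assms(2) by force
  have "sum h (Pow u) = (- 1) ^ k * sum h (Pow (- u))"
    using null_design_sum_Pow_Compl[OF assms(1), of "- u"] by simp
  then show "k \<le> card (- u)" using vanish[of "- u"] assms(2) by force
qed

lemma ftilde_eq_sum_Pow:
  assumes "harmonic k f"
  shows "ftilde k f u = sum f (Pow u)"
  unfolding ftilde_def using assms
  by (intro sum.mono_neutral_left) (auto simp: harmonic_def RX_def)

lemma ftilde_empty:
  assumes "k > 0" "harmonic k f"
  shows "ftilde k f {} = 0"
  unfolding ftilde_eq_sum_Pow[OF assms(2)]
  using assms by (intro homogeneous_sum_Pow_eq_0[of k])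
    (auto intro: null_design_homogeneous harmonic_imp_null_design)

lemma ftilde_UNIV:
  assumes "k > 0" "harmonic k f"
  shows "ftilde k f UNIV = 0"
  using null_design_sum_Pow_Compl[OF harmonic_imp_null_design[OF assms(2)], of "{}"]
    ftilde_empty[OF assms]
  by (simp add: ftilde_eq_sum_Pow[OF assms(2)])

lemma ftilde_Int:
  assumes "\<And>z. z \<in> ksubsets k \<Longrightarrow> \<not> z \<subseteq> U \<Longrightarrow> f z = 0"
  shows "ftilde k f (u \<inter> U) = ftilde k f u"
  unfolding ftilde_def using assms
  by (intro sum.mono_neutral_left) auto

section \<open>The MacWilliams identity for harmonic weight enumerators\<close>

definition linear_code :: "('v \<Rightarrow> bit) set \<Rightarrow> bool"
  where "linear_code D \<longleftrightarrow> (\<lambda>_. 0) \<in> D \<and> (\<forall>c\<in>D. \<forall>d\<in>D. (\<lambda>x. c x + d x) \<in> D)"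

definition weight_term ::
    "('v::finite set \<Rightarrow> 'r::comm_ring_1) \<Rightarrow> 'r \<Rightarrow> 'r \<Rightarrow> ('v \<Rightarrow> bit) \<Rightarrow> 'r"
  where "weight_term h X Y v =
    sum h (Pow (supp UNIV v)) * X ^ (CARD('v) - wt UNIV v) * Y ^ wt UNIV v"

definition bit_sign :: "bit \<Rightarrow> 'r::comm_ring_1"
  where "bit_sign b = (if b = 0 then 1 else - 1)"

definition walsh_transform :: "(('v::finite \<Rightarrow> bit) \<Rightarrow> 'r::comm_ring_1) \<Rightarrow> ('v \<Rightarrow> bit) \<Rightarrow> 'r"
  where "walsh_transform g c = (\<Sum>v\<in>UNIV. bit_sign (\<Sum>x\<in>UNIV. c x * v x) * g v)"

lemma bit_sign_0 [simp]: "bit_sign 0 = 1"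
  by (simp add: bit_sign_def)

lemma bit_sign_1 [simp]: "bit_sign 1 = - 1"
  by (simp add: bit_sign_def)

lemma bit_sign_add: "bit_sign (a + b) = bit_sign a * bit_sign b"
  by (cases a; cases b) simp_all

lemma bit_sign_sum: "bit_sign (\<Sum>i\<in>A. g i) = (\<Prod>i\<in>A. bit_sign (g i))"
  by (induction A rule: infinite_finite_induct) (simp_all add: bit_sign_add)

lemma sum_bit_sign_linear_code:
  fixes D :: "('v::finite \<Rightarrow> bit) set"
  assumes "linear_code D"
  shows "(\<Sum>c\<in>D. bit_sign (\<Sum>x\<in>UNIV. c x * v x)) =
    (if v \<in> dual_code D then of_nat (card D) else 0 :: 'r::{idom,ring_char_0})"
proof (cases "v \<in> dual_code D")
  case True
  then show ?thesis by (simp add: dual_code_def)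
next
  case False
  then obtain e where e_mem: "e \<in> D" and e_v: "(\<Sum>x\<in>UNIV. e x * v x) = 1"
    by (auto simp: dual_code_def)
  let ?S = "\<Sum>c\<in>D. bit_sign (\<Sum>x\<in>UNIV. c x * v x) :: 'r"
  have "?S = (\<Sum>c\<in>D. bit_sign (\<Sum>x\<in>UNIV. (e x + c x) * v x))"
    by (rule sum.reindex_bij_witness[where i = "\<lambda>c x. e x + c x" and j = "\<lambda>c x. e x + c x"])
      (use assms e_mem in \<open>simp_all add: linear_code_def\<close>)
  also have "\<dots> = - ?S"
    by (simp add: distrib_right sum.distrib bit_sign_add e_v sum_negf)
  finally show ?thesis using False by simp
qed

lemma poisson_summation_dual_code:
  fixes g :: "('v::finite \<Rightarrow> bit) \<Rightarrow> 'r::{idom,ring_char_0}"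
  assumes "linear_code D"
  shows "of_nat (card D) * (\<Sum>d\<in>dual_code D. g d) = (\<Sum>c\<in>D. walsh_transform g c)"
proof -
  have "(\<Sum>c\<in>D. walsh_transform g c)
      = (\<Sum>v\<in>UNIV. (\<Sum>c\<in>D. bit_sign (\<Sum>x\<in>UNIV. c x * v x)) * g v)"
    unfolding walsh_transform_def by (subst sum.swap) (simp add: sum_distrib_right)
  also have "\<dots> = (\<Sum>v\<in>UNIV. if v \<in> dual_code D then of_nat (card D) * g v else 0)"
    by (intro sum.cong) (simp_all add: sum_bit_sign_linear_code[OF assms])
  also have "\<dots> = of_nat (card D) * (\<Sum>d\<in>dual_code D. g d)"
    by (simp add: sum.If_cases sum_distrib_left)
  finally show ?thesis ..
qed

lemma bij_betw_supp: "bij_betw (supp UNIV) (UNIV :: ('v \<Rightarrow> bit) set) UNIV"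
  by (rule bij_betwI[where g = "\<lambda>S x. if x \<in> S then 1 else 0"])
    (auto simp: supp_def fun_eq_iff)

lemma bit_sign_inner_product:
  fixes c v :: "'v::finite \<Rightarrow> bit"
  shows "bit_sign (\<Sum>x\<in>UNIV. c x * v x) = (\<Prod>x\<in>supp UNIV v. bit_sign (c x))"
proof -
  have "bit_sign (\<Sum>x\<in>UNIV. c x * v x) = (\<Prod>x\<in>UNIV. bit_sign (c x * v x))"
    by (rule bit_sign_sum)
  also have "\<dots> = (\<Prod>x\<in>supp UNIV v. bit_sign (c x * v x))"
    by (intro prod.mono_neutral_right) (auto simp: supp_def)
  also have "\<dots> = (\<Prod>x\<in>supp UNIV v. bit_sign (c x))"
    by (intro prod.cong) (auto simp: supp_def)
  finally show ?thesis .
qed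

lemma sum_supersets_prod:
  fixes a b :: "'v::finite \<Rightarrow> 'r::comm_ring_1"
  shows "(\<Sum>S | z \<subseteq> S. (\<Prod>i\<in>S. a i) * (\<Prod>i\<in>-S. b i)) = (\<Prod>i\<in>z. a i) * (\<Prod>i\<in>-z. a i + b i)"
proof -
  have "(\<Sum>S | z \<subseteq> S. (\<Prod>i\<in>S. a i) * (\<Prod>i\<in>-S. b i))
      = (\<Sum>T\<in>Pow (- z). (\<Prod>i\<in>z. a i) * ((\<Prod>i\<in>T. a i) * (\<Prod>i\<in>- z - T. b i)))"
  proof (rule sum.reindex_bij_witness[where i = "\<lambda>T. z \<union> T" and j = "\<lambda>S. S - z"])
    fix S assume "S \<in> {S. z \<subseteq> S}"
    then have S: "z \<subseteq> S" by simp
    then show "z \<union> (S - z) = S" "S - z \<in> Pow (- z)" by auto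
    have "(\<Prod>i\<in>S. a i) = (\<Prod>i\<in>z. a i) * (\<Prod>i\<in>S - z. a i)"
      using S by (subst prod.subset_diff[of z S]) (simp_all add: mult.commute)
    moreover have "- z - (S - z) = - S" using S by auto
    ultimately show "(\<Prod>i\<in>z. a i) * ((\<Prod>i\<in>S - z. a i) * (\<Prod>i\<in>- z - (S - z). b i))
        = (\<Prod>i\<in>S. a i) * (\<Prod>i\<in>-S. b i)"
      by (simp add: mult.assoc)
  qed auto
  also have "\<dots> = (\<Prod>i\<in>z. a i) * (\<Prod>i\<in>-z. a i + b i)"
    by (simp add: prod_add sum_distrib_left)
  finally show ?thesis .
qed

lemma CARD_minus_wt: "CARD('v) - wt UNIV c = card (- supp UNIV c)"
  for c :: "'v::finite \<Rightarrow> bit"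
  by (simp add: wt_def Compl_eq_Diff_UNIV card_Diff_subset)

lemma walsh_transform_weight_term:
  "walsh_transform (weight_term h X Y) c
    = (\<Sum>z\<in>UNIV. h z * ((\<Prod>i\<in>z. bit_sign (c i) * Y) * (\<Prod>i\<in>-z. bit_sign (c i) * Y + X)))"
    (is "?L = ?R")
proof -
  let ?p = "\<lambda>S. (\<Prod>i\<in>S. bit_sign (c i) * Y) * (\<Prod>i\<in>-S. X)"
  have "?L = (\<Sum>v\<in>UNIV. (\<lambda>S. sum h (Pow S) * ?p S) (supp UNIV v))"
    unfolding walsh_transform_def weight_term_def bit_sign_inner_product[of c] CARD_minus_wt
    by (simp add: wt_def prod.distrib ac_simps)
  also have "\<dots> = (\<Sum>S\<in>UNIV. sum h (Pow S) * ?p S)"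
    by (rule sum.reindex_bij_betw[OF bij_betw_supp])
  also have "\<dots> = (\<Sum>S\<in>UNIV. \<Sum>z | z \<in> UNIV \<and> z \<subseteq> S. h z * ?p S)"
    by (simp add: sum_distrib_right Pow_def)
  also have "\<dots> = (\<Sum>z\<in>UNIV. \<Sum>S | S \<in> UNIV \<and> z \<subseteq> S. h z * ?p S)"
    by (rule sum.swap_restrict) simp_all
  also have "\<dots> = (\<Sum>z\<in>UNIV. h z * (\<Sum>S | z \<subseteq> S. ?p S))"
    by (simp add: sum_distrib_left)
  also have "\<dots> = ?R"
    by (simp only: sum_supersets_prod)
  finally show ?thesis .
qed

lemma prod_bit_sign_plus:
  fixes c :: "'v::finite \<Rightarrow> bit" and X Y :: "'r::comm_ring_1"
  shows "(\<Prod>i\<in>UNIV. bit_sign (c i) * Y + X)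
    = (X + Y) ^ (CARD('v) - wt UNIV c) * (X - Y) ^ wt UNIV c"
proof -
  let ?p = "\<lambda>i. bit_sign (c i) * Y + X"
  have "(\<Prod>i\<in>UNIV. ?p i) = (\<Prod>i\<in>- supp UNIV c. ?p i) * (\<Prod>i\<in>supp UNIV c. ?p i)"
    by (subst prod.union_disjoint[symmetric]) (auto intro: prod.cong)
  also have "(\<Prod>i\<in>- supp UNIV c. ?p i) = (\<Prod>i\<in>- supp UNIV c. X + Y)"
    by (intro prod.cong) (auto simp: supp_def add.commute)
  also have "(\<Prod>i\<in>supp UNIV c. ?p i) = (\<Prod>i\<in>supp UNIV c. X - Y)"
    by (intro prod.cong) (auto simp: supp_def)
  finally show ?thesis by (simp add: CARD_minus_wt) (simp add: wt_def)
qed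

text \<open>
  Multiplying by \<open>(X\<^sup>2 - Y\<^sup>2)\<^sup>k\<close> completes the product over the complement of \<open>z\<close> to the whole
  coordinate set; the remaining factors \<open>s\<^sub>i Y (X - s\<^sub>i Y) = X Y s\<^sub>i - Y\<^sup>2\<close> are, up to a translation,
  \<open>X Y (s\<^sub>i - 1)\<close>.
\<close>

lemma power_times_walsh_transform_weight_term:
  fixes h :: "'v::finite set \<Rightarrow> 'r::comm_ring_1"
  assumes "null_design k h"
  shows "((X + Y) * (X - Y)) ^ k * walsh_transform (weight_term h X Y) c
    = (- 2 * X * Y) ^ k * weight_term h (X + Y) (X - Y) c"
proof -
  note homogeneous = null_design_homogeneous[OF assms]
  define s :: "'v \<Rightarrow> 'r" where "s i = bit_sign (c i)" for i
  define P where "P = (\<Prod>i\<in>UNIV. s i * Y + X)"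
  have split_P: "P = (\<Prod>i\<in>z. s i * Y + X) * (\<Prod>i\<in>-z. s i * Y + X)" for z
    unfolding P_def by (subst prod.union_disjoint[symmetric]) (auto intro: prod.cong)
  have "((X + Y) * (X - Y)) ^ k * walsh_transform (weight_term h X Y) c
      = P * multilinear_form h (\<lambda>i. s i * Y * (X - s i * Y))"
    unfolding walsh_transform_weight_term multilinear_form_def sum_distrib_left
      mult.left_commute[of _ "h _"] s_def[symmetric]
  proof (intro sum.cong refl homogeneous_mult_cong[OF homogeneous])
    fix z :: "'v set" assume "card z = k"
    have "(X + Y) * (X - Y) = (s i * Y + X) * (X - s i * Y)" for i
      by (cases "c i") (simp_all add: s_def algebra_simps)
    then have "((X + Y) * (X - Y)) ^ k = (\<Prod>i\<in>z. (s i * Y + X) * (X - s i * Y))"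
      using \<open>card z = k\<close> by simp
    then show "((X + Y) * (X - Y)) ^ k * ((\<Prod>i\<in>z. s i * Y) * (\<Prod>i\<in>-z. s i * Y + X))
        = P * (\<Prod>i\<in>z. s i * Y * (X - s i * Y))"
      by (simp add: split_P[of z] prod.distrib ac_simps)
  qed
  also have "(\<lambda>i. s i * Y * (X - s i * Y))
      = (\<lambda>i. - 2 * X * Y * of_bool (i \<in> supp UNIV c) + (X * Y - Y * Y))"
    by (auto simp: s_def supp_def fun_eq_iff bit_sign_def algebra_simps)
  also have "multilinear_form h \<dots> = (- 2 * X * Y) ^ k * sum h (Pow (supp UNIV c))"
    by (simp only: multilinear_form_translation[OF assms] multilinear_form_scale[OF homogeneous]
        multilinear_form_indicator)
  finally show ?thesis
    unfolding P_def s_def prod_bit_sign_plus weight_term_def[of h "X + Y"]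
    by (simp only: ac_simps)
qed

lemma weight_term_null_design_cancel:
  fixes h :: "'v::finite set \<Rightarrow> 'r::comm_ring_1"
  assumes "null_design k h"
  shows "weight_term h X Y c = (X * Y) ^ k *
    (sum h (Pow (supp UNIV c)) * (X ^ (CARD('v) - wt UNIV c - k) * Y ^ (wt UNIV c - k)))"
proof (cases "sum h (Pow (supp UNIV c)) = 0")
  case True
  then show ?thesis by (simp add: weight_term_def)
next
  case False
  then have "k \<le> wt UNIV c" "k \<le> CARD('v) - wt UNIV c"
    unfolding CARD_minus_wt using null_design_sum_Pow_nonzero[OF assms] by (simp_all add: wt_def)
  then have "X ^ (CARD('v) - wt UNIV c) = X ^ k * X ^ (CARD('v) - wt UNIV c - k)"
    "Y ^ wt UNIV c = Y ^ k * Y ^ (wt UNIV c - k)"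
    by (simp_all flip: power_add del: diff_diff_left)
  then show ?thesis
    unfolding weight_term_def by (simp only: power_mult_distrib ac_simps)
qed

lemma walsh_transform_null_design:
  fixes h :: "'v::finite set \<Rightarrow> 'r::idom"
  assumes null_design: "null_design k h" and nonzero: "(X + Y) * (X - Y) \<noteq> 0"
  shows "walsh_transform (weight_term h X Y) c = (- 2 * X * Y) ^ k *
    (sum h (Pow (supp UNIV c)) *
      ((X + Y) ^ (CARD('v) - wt UNIV c - k) * (X - Y) ^ (wt UNIV c - k)))"
    (is "_ = ?R")
proof -
  have "((X + Y) * (X - Y)) ^ k * walsh_transform (weight_term h X Y) c
      = ((X + Y) * (X - Y)) ^ k * ?R"
    unfolding power_times_walsh_transform_weight_term[OF null_design]
      weight_term_null_design_cancel[OF null_design, of "X + Y"]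
    by (rule mult.left_commute)
  then show ?thesis using nonzero by simp
qed

lemma const_xy_0 [simp]: "const_xy 0 = 0"
  by (simp add: const_xy_def)

lemma const_xy_1 [simp]: "const_xy 1 = 1"
  by (simp add: const_xy_def one_pCons)

lemma const_xy_add: "const_xy (a + b) = const_xy a + const_xy b"
  by (simp add: const_xy_def)

lemma const_xy_mult: "const_xy (a * b) = const_xy a * const_xy b"
  by (simp add: const_xy_def)

lemma const_xy_sum: "const_xy (\<Sum>i\<in>A. g i) = (\<Sum>i\<in>A. const_xy (g i))"
  by (induction A rule: infinite_finite_induct) (simp_all add: const_xy_add)

lemma const_xy_numeral: "const_xy (numeral n) = numeral n"
  by (simp add: const_xy_def numeral_poly)

lemma const_xy_power: "const_xy (a ^ n) = const_xy a ^ n"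
  by (induction n) (simp_all add: const_xy_mult)

lemma const_xy_inverse_sqrt2_power:
  "(const_xy (1 / sqrt 2) * p) ^ n * (const_xy (1 / sqrt 2) * q) ^ n
    = const_xy ((1 / 2) ^ n) * (p ^ n * q ^ n)"
proof -
  have "const_xy (1 / sqrt 2) ^ n * const_xy (1 / sqrt 2) ^ n = const_xy ((1 / 2) ^ n)"
    by (simp flip: const_xy_power const_xy_mult power_mult_distrib)
  then show ?thesis by (simp only: power_mult_distrib flip: mult.assoc) (simp add: ac_simps)
qed

lemma null_design_const_xy:
  assumes "null_design k f"
  shows "null_design k (\<lambda>z. const_xy (f z))"
  using assms by (simp add: null_design_def homogeneous_def flip: const_xy_sum)

theorem macwilliams_harmonic:
  fixes D :: "('v::finite \<Rightarrow> bit) set"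
  assumes linear: "linear_code D" and harmonic: "harmonic k f"
  shows "of_nat (card D) * harmonic_weight_enum (dual_code D) k f
    = (- 2 * var_x * var_y) ^ k *
      (\<Sum>c\<in>D. const_xy (ftilde k f (supp UNIV c)) *
        ((var_x + var_y) ^ (CARD('v) - wt UNIV c - k) * (var_x - var_y) ^ (wt UNIV c - k)))"
proof -
  let ?F = "\<lambda>z. const_xy (f z)"
  have null_design: "null_design k ?F"
    using harmonic by (intro null_design_const_xy harmonic_imp_null_design)
  have nonzero: "(var_x + var_y) * (var_x - var_y) \<noteq> 0"
    by (simp add: var_x_def var_y_def)
  have const_ftilde: "const_xy (ftilde k f u) = sum ?F (Pow u)" for u
    by (simp add: ftilde_eq_sum_Pow[OF harmonic] const_xy_sum)
  have "of_nat (card D) * harmonic_weight_enum (dual_code D) k f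
      = (\<Sum>c\<in>D. walsh_transform (weight_term ?F var_x var_y) c)"
    unfolding harmonic_weight_enum_def const_ftilde weight_term_def[symmetric]
    by (rule poisson_summation_dual_code[OF linear])
  also have "\<dots> = (- 2 * var_x * var_y) ^ k *
      (\<Sum>c\<in>D. const_xy (ftilde k f (supp UNIV c)) *
        ((var_x + var_y) ^ (CARD('v) - wt UNIV c - k) * (var_x - var_y) ^ (wt UNIV c - k)))"
    unfolding walsh_transform_null_design[OF null_design nonzero] const_ftilde
    by (rule sum_distrib_left[symmetric])
  finally show ?thesis .
qed

section \<open>Linear algebra over a finite field\<close>

lemma (in vector_space) card_span_independent:
  assumes "finite B" "independent B"
  shows "card (span B) = CARD('a) ^ card B"
proof -
  let ?comb = "\<lambda>u. \<Sum>v\<in>B. u v *s v"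
  have "inj_on ?comb (B \<rightarrow>\<^sub>E UNIV)"
  proof (rule inj_onI)
    fix u w assume u: "u \<in> B \<rightarrow>\<^sub>E UNIV" and w: "w \<in> B \<rightarrow>\<^sub>E UNIV" and "?comb u = ?comb w"
    then have diff: "(\<Sum>v\<in>B. (u v - w v) *s v) = 0"
      by (simp add: scale_left_diff_distrib sum_subtractf)
    have "u v = w v" if "v \<in> B" for v
      using independentD[OF assms(2,1) subset_refl diff that] by simp
    then show "u = w"
      by (rule PiE_ext[OF u w])
  qed
  moreover have "?comb ` (B \<rightarrow>\<^sub>E UNIV) = span B"
  proof (intro subset_antisym image_subsetI subsetI)
    show "?comb u \<in> span B" for u
      by (intro span_sum span_scale span_base)
  next
    fix x assume "x \<in> span B"
    then obtain u where "x = ?comb u" using assms(1) by (auto simp: span_finite)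
    then have "x = ?comb (restrict u B)" by simp
    moreover have "restrict u B \<in> B \<rightarrow>\<^sub>E UNIV" by simp
    ultimately show "x \<in> ?comb ` (B \<rightarrow>\<^sub>E UNIV)" by (rule image_eqI)
  qed
  ultimately have "card (B \<rightarrow>\<^sub>E (UNIV :: 'a set)) = card (span B)"
    by (intro bij_betw_same_card[of ?comb] bij_betw_imageI)
  then show ?thesis using assms(1) by (simp add: card_PiE)
qed

lemma independent_extend_basis:
  fixes B :: "('a::field ^ 'm) set"
  assumes "vec.independent B"
  obtains E where "B \<subseteq> E" "vec.independent E" "vec.span E = UNIV" "card E = CARD('m)"
proof -
  obtain E where "B \<subseteq> E" and independent: "vec.independent E"
    and spanning: "UNIV \<subseteq> vec.span E"
    by (rule vec.maximal_independent_subset_extend[OF subset_UNIV assms])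
  moreover have "card E = CARD('m)"
    using vec.basis_card_eq_dim[OF subset_UNIV spanning independent]
      vec_dim_card[where 'a = 'a and 'n = 'm]
    by metis
  ultimately show thesis using that independent spanning by blast
qed

lemma zero_notin_independent: "vec.independent B \<Longrightarrow> 0 \<notin> B"
  using vec.dependent_zero by blast

lemma card_vec_subspace:
  fixes U :: "('a::{field,finite} ^ 'm) set"
  assumes "vec.subspace U"
  shows "card U = CARD('a) ^ vec.dim U"
proof -
  obtain B where "B \<subseteq> U" and independent: "vec.independent B"
    and "U \<subseteq> vec.span B" and card_B: "card B = vec.dim U"
    by (rule vec.basis_exists)
  then have "U = vec.span B"
    using vec.span_minimal[OF \<open>B \<subseteq> U\<close> assms] by auto
  then show ?thesis
    using vec.card_span_independent[OF _ independent] by (simp add: card_B)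
qed

section \<open>First-order Reed--Muller codes\<close>

lemma CARD_bit: "CARD(bit) = 2"
proof -
  have UNIV_bit: "(UNIV :: bit set) = {0, 1}" by (auto intro: bit.exhaust)
  show ?thesis unfolding UNIV_bit by simp
qed

lemma CARD_bit_vec: "CARD(bit ^ 'm) = 2 * 2 ^ (CARD('m) - 1)"
  by (simp add: CARD_vec CARD_bit flip: power_Suc)

interpretation functional: vector_space_pair "(*s) :: bit \<Rightarrow> bit ^ 'm \<Rightarrow> bit ^ 'm" "(*)"
  by unfold_locales

lemma RM1E:
  assumes "c \<in> RM1"
  obtains l b where "c = (\<lambda>x. l x + b)" "Vector_Spaces.linear (*s) (*) l"
  using assms by (auto simp: RM1_def)

lemma RM1I: "Vector_Spaces.linear (*s) (*) l \<Longrightarrow> (\<lambda>x. l x + b) \<in> RM1"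
  by (auto simp: RM1_def)

lemma linear_code_RM1: "linear_code RM1"
  unfolding linear_code_def
proof (intro conjI ballI)
  show "(\<lambda>_. 0) \<in> RM1"
    using RM1I[OF functional.linear_zero, of 0] by simp
next
  fix c d :: "bit ^ 'm \<Rightarrow> bit"
  assume "c \<in> RM1" "d \<in> RM1"
  then obtain l b l' b' where c_d_eq: "c = (\<lambda>x. l x + b)" "d = (\<lambda>x. l' x + b')"
    and linear_l: "Vector_Spaces.linear (*s) (*) l"
    and linear_l': "Vector_Spaces.linear (*s) (*) l'"
    by (metis RM1E)
  show "(\<lambda>x. c x + d x) \<in> RM1"
    using RM1I[OF functional.linear_compose_add[OF linear_l linear_l'], of "b + b'"]
    by (simp add: c_d_eq ac_simps)
qed

lemma RM1_add_arg:
  assumes "c \<in> RM1"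
  shows "c (x + y) = c x + (c y + c 0)"
proof -
  obtain l b where "c = (\<lambda>x. l x + b)" "Vector_Spaces.linear (*s) (*) l"
    using assms by (rule RM1E)
  then show ?thesis
    by (simp add: functional.linear_add functional.linear_0 ac_simps)
qed

lemma RM1_eq_on_span:
  assumes "c \<in> RM1" "d \<in> RM1" "\<And>x. x \<in> insert 0 B \<Longrightarrow> c x = d x" "x \<in> vec.span B"
  shows "c x = d x"
proof -
  obtain l b l' b' where c_d_eq: "c = (\<lambda>x. l x + b)" "d = (\<lambda>x. l' x + b')"
    and linear_l: "Vector_Spaces.linear (*s) (*) l"
    and linear_l': "Vector_Spaces.linear (*s) (*) l'"
    using assms(1,2) by (metis RM1E)
  have "b = b'"
    using assms(3)[of 0]
    by (simp add: c_d_eq functional.linear_0[OF linear_l] functional.linear_0[OF linear_l'])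
  then have "l y = l' y" if "y \<in> B" for y
    using assms(3)[of y] that by (simp add: c_d_eq)
  then have "l x = l' x"
    by (rule functional.linear_eq_on[OF linear_l linear_l' assms(4)])
  then show ?thesis by (simp add: c_d_eq \<open>b = b'\<close>)
qed

lemma RM1_extension:
  assumes "vec.independent B"
  obtains c where "c \<in> RM1" "\<And>x. x \<in> insert 0 B \<Longrightarrow> c x = g x"
proof -
  obtain l where linear_l: "Vector_Spaces.linear (*s) (*) l" and l_B: "\<forall>x\<in>B. l x = g x + g 0"
    using functional.linear_independent_extend[OF assms, of "\<lambda>x. g x + g 0"] by blast
  show thesis
  proof
    show "(\<lambda>x. l x + g 0) \<in> RM1" using linear_l by (rule RM1I)
    show "l x + g 0 = g x" if "x \<in> insert 0 B" for x
      using that l_B by (auto simp: functional.linear_0[OF linear_l] add.assoc)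
  qed
qed

lemma card_RM1_values:
  fixes E :: "(bit ^ 'm) set"
  assumes "vec.independent E" "vec.span E = UNIV"
  shows "card {c \<in> RM1. \<forall>x\<in>insert 0 E. c x \<in> T x} = (\<Prod>x\<in>insert 0 E. card (T x))"
proof -
  let ?S = "{c \<in> RM1. \<forall>x\<in>insert 0 E. c x \<in> T x}" and ?r = "\<lambda>c. restrict c (insert 0 E)"
  have "inj_on ?r ?S"
  proof (rule inj_onI)
    fix c d assume mem: "c \<in> ?S" "d \<in> ?S" and eq: "?r c = ?r d"
    have "c x = d x" if "x \<in> insert 0 E" for x
      using eq that by (metis restrict_apply')
    then show "c = d"
      using RM1_eq_on_span[of c d E] mem assms(2) by (intro ext) auto
  qed
  moreover have "?r ` ?S = Pi\<^sub>E (insert 0 E) T"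
  proof (intro subset_antisym image_subsetI subsetI)
    fix c assume "c \<in> ?S"
    then show "?r c \<in> Pi\<^sub>E (insert 0 E) T"
      unfolding restrict_PiE_iff by blast
  next
    fix g assume g: "g \<in> Pi\<^sub>E (insert 0 E) T"
    obtain c where "c \<in> RM1" and c_eq: "\<And>x. x \<in> insert 0 E \<Longrightarrow> c x = g x"
      using RM1_extension[OF assms(1), of g] by blast
    have "?r c = g"
      using c_eq PiE_restrict[OF g] by (metis restrict_ext)
    moreover have "c \<in> ?S"
      using \<open>c \<in> RM1\<close> c_eq PiE_mem[OF g] by simp
    ultimately show "g \<in> ?r ` ?S" by blast
  qed
  ultimately have "card ?S = card (Pi\<^sub>E (insert 0 E) T)"
    by (intro bij_betw_same_card[of ?r] bij_betw_imageI)
  then show ?thesis by (simp add: card_PiE)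
qed

lemma card_RM1: "card (RM1 :: (bit ^ 'm \<Rightarrow> bit) set) = 2 ^ (CARD('m) + 1)"
proof -
  obtain E :: "(bit ^ 'm) set" where independent: "vec.independent E"
    and spanning: "vec.span E = UNIV" and card_E: "card E = CARD('m)"
    by (rule independent_extend_basis[OF vec.independent_empty])
  show ?thesis
    using card_RM1_values[OF independent spanning, of "\<lambda>_. UNIV"]
      zero_notin_independent[OF independent]
    by (simp add: CARD_bit card_E)
qed

lemma RM1_restrict_eq_iff:
  assumes "c \<in> RM1" "d \<in> RM1" "vec.subspace U" "B \<subseteq> U" "U \<subseteq> vec.span B"
  shows "restrict c U = restrict d U \<longleftrightarrow> (\<forall>x\<in>insert 0 B. c x = d x)"
proof
  assume "restrict c U = restrict d U"
  then have "c x = d x" if "x \<in> U" for x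
    using that by (metis restrict_apply')
  then show "\<forall>x\<in>insert 0 B. c x = d x"
    using assms(4) vec.subspace_0[OF assms(3)] by auto
next
  assume "\<forall>x\<in>insert 0 B. c x = d x"
  then show "restrict c U = restrict d U"
    using RM1_eq_on_span[OF assms(1,2)] assms(5) by (intro restrict_ext) blast
qed

lemma card_RM1_fibre:
  fixes U :: "(bit ^ 'm) set"
  assumes subspace: "vec.subspace U" and "d \<in> RM1"
  shows "card {c \<in> RM1. restrict c U = restrict d U} = 2 ^ (CARD('m) - vec.dim U)"
proof -
  obtain B where B: "B \<subseteq> U" "U \<subseteq> vec.span B" and independent_B: "vec.independent B"
    and card_B: "card B = vec.dim U"
    by (rule vec.basis_exists)
  obtain E where "B \<subseteq> E" and independent_E: "vec.independent E"
    and spanning: "vec.span E = UNIV" and card_E: "card E = CARD('m)"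
    by (rule independent_extend_basis[OF independent_B])
  let ?T = "\<lambda>x. if x \<in> insert 0 B then {d x} else UNIV"
  have "(\<forall>x\<in>insert 0 B. c x = d x) \<longleftrightarrow> (\<forall>x\<in>insert 0 E. c x \<in> ?T x)" for c
    using \<open>B \<subseteq> E\<close> by auto
  then have "{c \<in> RM1. restrict c U = restrict d U} = {c \<in> RM1. \<forall>x\<in>insert 0 E. c x \<in> ?T x}"
    using RM1_restrict_eq_iff[OF _ \<open>d \<in> RM1\<close> subspace B] by blast
  then have "card {c \<in> RM1. restrict c U = restrict d U} = (\<Prod>x\<in>insert 0 E. card (?T x))"
    by (simp only: card_RM1_values[OF independent_E spanning])
  also have "\<dots> = (\<Prod>x\<in>insert 0 E - insert 0 B. card (UNIV :: bit set))"
    by (intro prod.mono_neutral_cong_right) auto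
  also have "insert 0 E - insert 0 B = E - B"
    using zero_notin_independent[OF independent_E] by auto
  also have "(\<Prod>x\<in>E - B. card (UNIV :: bit set)) = 2 ^ (CARD('m) - vec.dim U)"
    using \<open>B \<subseteq> E\<close> by (simp add: CARD_bit card_Diff_subset card_B card_E)
  finally show ?thesis .
qed

lemma sum_RM1_restrict:
  fixes U :: "(bit ^ 'm) set" and g :: "(bit ^ 'm \<Rightarrow> bit) \<Rightarrow> 'r::comm_semiring_1"
  assumes "vec.subspace U"
  shows "(\<Sum>c\<in>RM1. g (restrict c U))
    = 2 ^ (CARD('m) - vec.dim U) * (\<Sum>a\<in>restrict_code U RM1. g a)"
proof -
  have "(\<Sum>c\<in>RM1. g (restrict c U))
      = (\<Sum>a\<in>restrict_code U RM1. \<Sum>c | c \<in> RM1 \<and> restrict c U = a. g (restrict c U))"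
    by (intro sum.group[symmetric]) (auto simp: restrict_code_def)
  also have "\<dots> = (\<Sum>a\<in>restrict_code U RM1. 2 ^ (CARD('m) - vec.dim U) * g a)"
  proof (intro sum.cong refl)
    fix a assume "a \<in> restrict_code U RM1"
    then obtain d where "d \<in> RM1" "a = restrict d U" by (auto simp: restrict_code_def)
    then show "(\<Sum>c | c \<in> RM1 \<and> restrict c U = a. g (restrict c U))
        = 2 ^ (CARD('m) - vec.dim U) * g a"
      using card_RM1_fibre[OF assms] by simp
  qed
  finally show ?thesis by (simp add: sum_distrib_left)
qed

text \<open>Translation by \<open>u\<close> with \<open>c u \<noteq> c 0\<close> exchanges the zeros and the ones of \<open>c\<close> on \<open>U\<close>.\<close>

lemma RM1_supp_cases:
  assumes subspace: "vec.subspace U" and affine: "c \<in> RM1"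
  obtains "supp U c = {}" | "supp U c = U" | "2 * wt U c = card U"
proof (cases "\<forall>u\<in>U. c u = c 0")
  case True
  then have "supp U c = {} \<or> supp U c = U"
    by (cases "c 0") (auto simp: supp_def)
  then show thesis using that by blast
next
  case False
  then obtain u where "u \<in> U" and c_u: "c u + c 0 = 1"
    by (cases "c 0") auto
  have flip: "c (x + u) = c x + 1" for x
    by (simp add: RM1_add_arg[OF affine, of x u] c_u)
  have "u + u = 0" by (simp add: vec_eq_iff)
  then have translate_twice: "x + u + u = x" for x by (simp add: add.assoc)
  have "bij_betw (\<lambda>x. x + u) (supp U c) (U - supp U c)"
    by (rule bij_betwI[where g = "\<lambda>x. x + u"])
      (use \<open>u \<in> U\<close> vec.subspace_add[OF subspace] flip translate_twice in \<open>auto simp: supp_def\<close>)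
  then have "card (supp U c) = card (U - supp U c)"
    by (rule bij_betw_same_card)
  also have "\<dots> = card U - card (supp U c)"
    by (intro card_Diff_subset) (auto simp: supp_def)
  finally have "2 * wt U c = card U"
    using card_mono[of U "supp U c"] by (auto simp: wt_def supp_def)
  then show thesis using that by blast
qed

section \<open>Harmonic functions supported on a subspace\<close>

locale harmonic_on_subspace =
  fixes U :: "(bit ^ 'm) set" and k :: nat and f :: "(bit ^ 'm) set \<Rightarrow> real"
  assumes subspace: "vec.subspace U"
    and degree_pos: "k > 0"
    and harmonic: "harmonic k f"
    and supported: "\<And>z. z \<in> ksubsets k \<Longrightarrow> \<not> z \<subseteq> U \<Longrightarrow> f z = 0"
begin

definition balanced_sum :: real
  where "balanced_sum =
    (\<Sum>a \<in> {a \<in> restrict_code U RM1. 2 * wt U a = card U}. ftilde k f (supp U a))"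

lemma ftilde_supp_restrict: "ftilde k f (supp U (restrict c U)) = ftilde k f (supp UNIV c)"
proof -
  have "supp U (restrict c U) = supp UNIV c \<inter> U" by (auto simp: supp_def)
  then show ?thesis by (simp add: ftilde_Int[of k U f, OF supported])
qed

lemma ftilde_superset:
  assumes "U \<subseteq> W"
  shows "ftilde k f W = 0"
proof -
  have "ftilde k f W = ftilde k f (W \<inter> U)" by (simp add: ftilde_Int[of k U f, OF supported])
  also have "W \<inter> U = UNIV \<inter> U" using assms by auto
  also have "ftilde k f (UNIV \<inter> U) = ftilde k f UNIV" by (rule ftilde_Int[OF supported])
  finally show ?thesis by (simp add: ftilde_UNIV[OF degree_pos harmonic])
qed

lemma RM1_balanced_if_ftilde_nonzero:
  assumes "vec.subspace W" "U \<subseteq> W" "c \<in> RM1" "ftilde k f (supp W c) \<noteq> 0"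
  shows "2 * wt W c = card W"
  using RM1_supp_cases[OF assms(1,3)]
  by cases (use assms(4) ftilde_empty[OF degree_pos harmonic] ftilde_superset[OF assms(2)] in auto)

lemma balanced_if_ftilde_restrict_code_nonzero:
  assumes "a \<in> restrict_code U RM1" "ftilde k f (supp U a) \<noteq> 0"
  shows "2 * wt U a = card U"
proof -
  obtain d where "d \<in> RM1" and "a = restrict d U"
    using assms(1) by (auto simp: restrict_code_def)
  then have "supp U a = supp U d" by (auto simp: supp_def)
  then show ?thesis
    using RM1_balanced_if_ftilde_nonzero[OF subspace subset_refl \<open>d \<in> RM1\<close>] assms(2)
    by (simp add: wt_def)
qed

lemma sum_ftilde_RM1:
  "(\<Sum>c\<in>RM1. ftilde k f (supp UNIV c)) = 2 ^ (CARD('m) - vec.dim U) * balanced_sum"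
proof -
  have "(\<Sum>c\<in>RM1. ftilde k f (supp UNIV c))
      = 2 ^ (CARD('m) - vec.dim U) * (\<Sum>a\<in>restrict_code U RM1. ftilde k f (supp U a))"
    unfolding ftilde_supp_restrict[symmetric] by (rule sum_RM1_restrict[OF subspace])
  also have "(\<Sum>a\<in>restrict_code U RM1. ftilde k f (supp U a)) = balanced_sum"
    unfolding balanced_sum_def using balanced_if_ftilde_restrict_code_nonzero
    by (intro sum.mono_neutral_right) auto
  finally show ?thesis .
qed

lemma sum_const_xy_ftilde_RM1:
  "(\<Sum>c\<in>RM1. const_xy (ftilde k f (supp UNIV c)) * g (wt UNIV c))
    = const_xy (2 ^ (CARD('m) - vec.dim U) * balanced_sum) * g (2 ^ (CARD('m) - 1))"
proof -
  have "wt UNIV c = 2 ^ (CARD('m) - 1)" if "c \<in> RM1" "ftilde k f (supp UNIV c) \<noteq> 0" for c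
  proof -
    have "2 * wt UNIV c = CARD(bit ^ 'm)"
      using that by (intro RM1_balanced_if_ftilde_nonzero) simp_all
    then show ?thesis by (simp add: CARD_bit_vec del: CARD_vec)
  qed
  then have "const_xy (ftilde k f (supp UNIV c)) * g (wt UNIV c)
      = const_xy (ftilde k f (supp UNIV c)) * g (2 ^ (CARD('m) - 1))" if "c \<in> RM1" for c
    using that by (cases "ftilde k f (supp UNIV c) = 0") auto
  then show ?thesis
    unfolding sum_ftilde_RM1[symmetric] const_xy_sum sum_distrib_right by (rule sum.cong[OF refl])
qed

lemma harmonic_weight_enum_RM1:
  "harmonic_weight_enum RM1 k f = 2 ^ (CARD('m) - vec.dim U) *
    var_x ^ (2 ^ (CARD('m) - 1)) * var_y ^ (2 ^ (CARD('m) - 1)) * const_xy balanced_sum"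
  unfolding harmonic_weight_enum_def mult.assoc
    sum_const_xy_ftilde_RM1[of "\<lambda>w. var_x ^ (CARD(bit ^ 'm) - w) * var_y ^ w"]
  by (simp add: CARD_bit_vec const_xy_mult const_xy_power const_xy_numeral ac_simps
      del: CARD_vec)

lemma macwilliams_harmonic_RM1:
  fixes N :: nat
  defines "N \<equiv> 2 ^ (CARD('m) - 1)"
  shows "2 ^ (CARD('m) + 1) * harmonic_weight_enum (dual_code RM1) k f =
    (- 2 * var_x * var_y) ^ k * (const_xy (2 ^ (CARD('m) - vec.dim U) * balanced_sum) *
      ((var_x + var_y) ^ (N - k) * (var_x - var_y) ^ (N - k)))"
proof -
  have "CARD(bit ^ 'm) - N = N"
    by (simp add: N_def CARD_bit_vec del: CARD_vec)
  then show ?thesis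
    using macwilliams_harmonic[OF linear_code_RM1 harmonic]
    by (simp only: card_RM1 of_nat_power of_nat_numeral N_def[symmetric]
        sum_const_xy_ftilde_RM1[of "\<lambda>w. (var_x + var_y) ^ (CARD(bit ^ 'm) - w - k) *
          (var_x - var_y) ^ (w - k)"])
qed

lemma balanced_sum_eq_0:
  assumes "2 ^ (CARD('m) - 1) < k"
  shows "balanced_sum = 0"
  unfolding balanced_sum_def
proof (intro sum.neutral ballI)
  fix a assume "a \<in> {a \<in> restrict_code U RM1. 2 * wt U a = card U}"
  then have "card (supp U a) < k"
    using card_mono[of UNIV U] assms by (simp add: CARD_bit_vec wt_def del: CARD_vec)
  then show "ftilde k f (supp U a) = 0"
    using null_design_homogeneous[OF harmonic_imp_null_design[OF harmonic]]
    by (simp add: ftilde_eq_sum_Pow[OF harmonic] homogeneous_sum_Pow_eq_0)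
qed

lemma harmonic_weight_enum_dual_RM1:
  fixes N :: nat
  defines "N \<equiv> 2 ^ (CARD('m) - 1)"
  assumes "vec.dim U < N"
  shows "harmonic_weight_enum (dual_code RM1) k f =
    (- 1) ^ k * (var_x * var_y) ^ k * 2 ^ (N - (vec.dim U + 1)) *
    (const_xy (1 / sqrt 2) * (var_x + var_y)) ^ (N - k) *
    (const_xy (1 / sqrt 2) * (var_x - var_y)) ^ (N - k) * const_xy balanced_sum"
    (is "_ = ?R")
proof (cases "k \<le> N")
  case False
  then have "balanced_sum = 0" by (intro balanced_sum_eq_0) (simp add: N_def)
  then show ?thesis using macwilliams_harmonic_RM1 by simp
next
  case True
  let ?xy = "(var_x + var_y) ^ (N - k) * (var_x - var_y) ^ (N - k)"
  have "vec.dim U \<le> CARD('m)"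
    by (metis vec.dim_subset[OF subset_UNIV] vec_dim_card)
  then have "(2::real) ^ (CARD('m) + 1) * 2 ^ (N - (vec.dim U + 1))
      = 2 ^ k * 2 ^ (CARD('m) - vec.dim U) * 2 ^ (N - k)"
    using True assms(2)
    by (simp flip: power_add power_Suc)
  then have scalar: "2 ^ (CARD('m) + 1) * (2 ^ (N - (vec.dim U + 1)) * (1 / 2) ^ (N - k))
      = (2::real) ^ k * 2 ^ (CARD('m) - vec.dim U)"
    by (simp add: power_one_over field_simps)
  have "?R = (- 1) ^ k * (var_x * var_y) ^ k *
      (const_xy (2 ^ (N - (vec.dim U + 1))) * const_xy balanced_sum *
        (const_xy ((1 / 2) ^ (N - k)) * ?xy))"
    unfolding const_xy_inverse_sqrt2_power[symmetric]
    by (simp only: const_xy_power const_xy_numeral ac_simps)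
  then have "2 ^ (CARD('m) + 1) * ?R = (- 1) ^ k * (var_x * var_y) ^ k *
      (const_xy (2 ^ (CARD('m) + 1) * (2 ^ (N - (vec.dim U + 1)) * (1 / 2) ^ (N - k)))
        * const_xy balanced_sum * ?xy)"
    by (simp only: const_xy_mult const_xy_power const_xy_numeral ac_simps)
  also have "\<dots> = (- 1 * 2) ^ k * (var_x * var_y) ^ k *
      (const_xy (2 ^ (CARD('m) - vec.dim U) * balanced_sum) * ?xy)"
    unfolding scalar
    by (simp only: const_xy_mult const_xy_power const_xy_numeral power_mult_distrib ac_simps)
  also have "\<dots> = 2 ^ (CARD('m) + 1) * harmonic_weight_enum (dual_code RM1) k f"
    using macwilliams_harmonic_RM1
    by (simp add: N_def power_mult_distrib[symmetric] mult.assoc)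
  finally show ?thesis by simp
qed

end

theorem theorem1p2:
  fixes m k :: nat
    and C H8 :: "(bit ^ 'm \<Rightarrow> bit) set"
    and U :: "(bit ^ 'm) set"
    and f :: "(bit ^ 'm) set \<Rightarrow> real"
  assumes "m = CARD('m)" and "m \<ge> 3"
    and "C = RM1"
    and "vec.subspace U" and "vec.dim U = 3"
    and "H8 = restrict_code U C"
    and "k > 0"
    and "harmonic k f"
    and "\<And>z. z \<in> ksubsets k \<Longrightarrow> \<not> z \<subseteq> U \<Longrightarrow> f z = 0"
  shows "harmonic_weight_enum C k f =
      2 ^ (m - 3) * var_x ^ (2 ^ (m - 1)) * var_y ^ (2 ^ (m - 1)) *
      const_xy (\<Sum>a \<in> {a \<in> H8. wt U a = 4}. ftilde k f (supp U a)) \<and>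
    harmonic_weight_enum (dual_code C) k f =
      (- 1) ^ k * (var_x * var_y) ^ k * 2 ^ (2 ^ (m - 1) - 4) *
      (const_xy (1 / sqrt 2) * (var_x + var_y)) ^ (2 ^ (m - 1) - k) *
      (const_xy (1 / sqrt 2) * (var_x - var_y)) ^ (2 ^ (m - 1) - k) *
      const_xy (\<Sum>a \<in> {a \<in> H8. wt U a = 4}. ftilde k f (supp U a))"
proof -
  interpret harmonic_on_subspace U k f
    using assms(4,7-9) by unfold_locales
  have "card U = 8"
    using card_vec_subspace[OF assms(4)] by (simp add: CARD_bit assms(5))
  then have balanced: "balanced_sum = (\<Sum>a \<in> {a \<in> H8. wt U a = 4}. ftilde k f (supp U a))"
    by (simp add: balanced_sum_def assms(3,6))
  have "(2::nat) ^ 2 \<le> 2 ^ (CARD('m) - 1)"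
    using assms(1,2) by (intro power_increasing) auto
  then have "vec.dim U < 2 ^ (CARD('m) - 1)"
    using assms(5) by simp
  then show ?thesis
    using harmonic_weight_enum_RM1 harmonic_weight_enum_dual_RM1
    unfolding balanced assms(1,3,5) by simp
qed

end
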